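(* Let $L>0$, $b>0$, and let $\beta\in C([-L,L])$ be nonnegative and satisfy $$\beta(0)\le\beta(x)\quad\text{for all }x\in(-L,L).$$ Let $u^b(x)=b$ for $x>0$ and $u^b(x)=0$ for $x<0$. Then $u^b$ solves $$\left(\beta\,\frac{u_x}{|u_x|}\right)_x=0\quad\text{in }(-L,L)$$ under the Dirichlet boundary condition $u(-L,t)=0$, $u(L,t)=b$; that is, $u^b$ is a stationary solution of $u_t=(\beta u_x/|u_x|)_x$ under this boundary condition.
   Context: Notion of solution: let $I=(p_0,p_1)$ be an open interval, $T>0$, $\beta\in C(I\times[0,T])$ nonnegative, and $g$ a boundary datum on $\partial I=\{p_0,p_1\}$. A function $u\in C([0,T),L^2(I))$ is a solution of $u_t=(\beta u_x/|u_x|)_x$ in $I\times(0,T)$ with $u=g$ on $\partial I$ if there is $z\in L^\infty(I\times(0,T))$ such that $$u_t=(\beta z)_x\ \text{ in } I\times(0,T),\qquad |z|\le1\ \text{ in } I\times(0,T),$$ $$-\int_I u\,(\beta z)_x\,dx=\int_I\beta|u_x|+\sum_{i=0}^1|\gamma u-g|(p_i)\,\beta(p_i,t).$$ Here $\int_I\beta|u_x|$ is the weighted total variation of $u$ with weight $\beta$, and $\gamma u$ is the trace of $u$ on $\partial I$. This notion mimics the $L^2(I)$-gradient flow of the energy $\Phi^t(u)=\int_I\beta(x,t)|u_x|+\sum_{i=0}^1|\gamma u-g|(p_i)\,\beta(p_i,t)$. In the claim, $p_0=-L$, $p_1=L$, $g(-L)=0$, $g(L)=b$, and $\beta$ does not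 depend on time; a stationary solution is a time-independent solution in this sense.
   Formalization: The energy identity is corrected for inhomogeneous data: the term g(p_1)(βz)(p_1) − g(p_0)(βz)(p_0), with traces of βz, is added to its left side; as printed, the identity would read 0 = bβ(0) for u^b, which is false when β(0)>0. *)

theory Defs
  imports "HOL-Analysis.Analysis"
begin

definition test_fun :: "real set \<Rightarrow> (real \<Rightarrow> real) \<Rightarrow> bool" where
  "test_fun I \<phi> \<longleftrightarrow>
     \<phi> C1_differentiable_on UNIV \<and>
     (\<exists>K. compact K \<and> K \<subseteq> I \<and> (\<forall>x. x \<notin> K \<longrightarrow> \<phi> x = 0))"

text \<open>The arguments \<open>\<phi>x\<close> and \<open>\<phi>t\<close> are the partial derivatives of \<open>\<phi>\<close>,
  a function of the pair (space, time).\<close>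

definition test_fun2 ::
    "(real \<times> real) set \<Rightarrow> (real \<times> real \<Rightarrow> real) \<Rightarrow> (real \<times> real \<Rightarrow> real) \<Rightarrow>
     (real \<times> real \<Rightarrow> real) \<Rightarrow> bool" where
  "test_fun2 \<Omega> \<phi> \<phi>x \<phi>t \<longleftrightarrow>
     (\<forall>p. (\<phi> has_derivative (\<lambda>h. \<phi>x p * fst h + \<phi>t p * snd h)) (at p)) \<and>
     continuous_on UNIV \<phi>x \<and> continuous_on UNIV \<phi>t \<and>
     (\<exists>K. compact K \<and> K \<subseteq> \<Omega> \<and> (\<forall>p. p \<notin> K \<longrightarrow> \<phi> p = 0))"

definition square_integrable_on :: "real set \<Rightarrow> (real \<Rightarrow> real) \<Rightarrow> bool" where
  "square_integrable_on I f \<longleftrightarrow>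
     set_borel_measurable lebesgue I f \<and> set_integrable lebesgue I (\<lambda>x. (f x)\<^sup>2)"

definition continuous_L2 :: "real set \<Rightarrow> real set \<Rightarrow> (real \<Rightarrow> real \<Rightarrow> real) \<Rightarrow> bool" where
  "continuous_L2 J I u \<longleftrightarrow>
     (\<forall>t\<in>J. square_integrable_on I (u t)) \<and>
     (\<forall>t\<in>J. ((\<lambda>s. LINT x:I|lebesgue. (u s x - u t x)\<^sup>2) \<longlongrightarrow> 0) (at t within J))"

definition locally_integrable :: "real set \<Rightarrow> (real \<Rightarrow> real) \<Rightarrow> bool" where
  "locally_integrable I f \<longleftrightarrow>
     (\<forall>K. compact K \<and> K \<subseteq> I \<longrightarrow> set_integrable lebesgue K f)"

definition has_weak_derivative :: "real set \<Rightarrow> (real \<Rightarrow> real) \<Rightarrow> (real \<Rightarrow> real) \<Rightarrow> bool" where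
  "has_weak_derivative I f w \<longleftrightarrow>
     locally_integrable I f \<and> locally_integrable I w \<and>
     (\<forall>\<phi>. test_fun I \<phi> \<longrightarrow>
        (LINT x:I|lebesgue. f x * deriv \<phi> x) = - (LINT x:I|lebesgue. w x * \<phi> x))"

text \<open>The trace at a boundary point \<open>p\<close> of \<open>I\<close>, as the limit in mean from inside \<open>I\<close>;
  the value \<open>c\<close> is unique, and for functions of bounded variation on an interval it is the
  one-sided limit of a good representative.\<close>

definition has_trace :: "real set \<Rightarrow> (real \<Rightarrow> real) \<Rightarrow> real \<Rightarrow> real \<Rightarrow> bool" where
  "has_trace I f p c \<longleftrightarrow>
     (\<forall>\<^sub>F r in at_right 0. set_integrable lebesgue (I \<inter> ball p r) f) \<and>
     ((\<lambda>r. (LINT x:(I \<inter> ball p r)|lebesgue. \<bar>f x - c\<bar>) / r) \<longlongrightarrow> 0) (at_right 0)"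

text \<open>The weighted total variation of \<open>u\<close> in duality form; for \<open>u\<close> of locally bounded
  variation and a continuous weight \<open>\<beta> \<ge> 0\<close> it is the integral of \<open>\<beta>\<close> against the
  variation measure of \<open>u\<close>.\<close>

definition weighted_tv :: "real set \<Rightarrow> (real \<Rightarrow> real) \<Rightarrow> (real \<Rightarrow> real) \<Rightarrow> ereal" where
  "weighted_tv I \<beta> u =
     (SUP \<phi>\<in>{\<phi>. test_fun I \<phi> \<and> (\<forall>x\<in>I. \<bar>\<phi> x\<bar> \<le> \<beta> x)}.
        ereal (LINT x:I|lebesgue. u x * deriv \<phi> x))"

definition tv_energy ::
    "real \<Rightarrow> real \<Rightarrow> (real \<Rightarrow> real) \<Rightarrow> (real \<Rightarrow> real) \<Rightarrow> (real \<Rightarrow> real) \<Rightarrow> (real \<Rightarrow> real) \<Rightarrow> ereal" where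
  "tv_energy p0 p1 \<beta> g u \<gamma> =
     weighted_tv {p0<..<p1} \<beta> u + ereal (\<Sum>p\<in>{p0, p1}. \<bar>\<gamma> p - g p\<bar> * \<beta> p)"

text \<open>\<open>u t x\<close> is the value of \<open>u\<close> at time \<open>t\<close> and position \<open>x\<close>; \<open>\<beta>\<close> and \<open>z\<close> take the position
  first.  The equation \<open>u\<^sub>t = (\<beta> z)\<^sub>x\<close> holds in the sense of distributions on
  \<open>(p0, p1) \<times> (0, T)\<close>.  Iterated integrals are used because continuity in time with values
  in \<open>L\<^sup>2\<close> does not make an arbitrary choice of representatives \<open>u t\<close> jointly measurable.

  In the energy identity, \<open>w\<close> is the derivative \<open>(\<beta> z)\<^sub>x\<close> at time \<open>t\<close>, \<open>\<gamma>\<close> is the trace of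
  \<open>u t\<close>, and \<open>q\<close> is the trace of the flux \<open>\<beta> z\<close>.  The boundary pairing
  \<open>g p1 * q p1 - g p0 * q p0\<close> vanishes for homogeneous data, which leaves
  \<open>- \<integral> u (\<beta> z)\<^sub>x = \<integral> \<beta> |u\<^sub>x| + \<Sum> |\<gamma> u - g| \<beta>\<close>.  For inhomogeneous data it comes from
  integration by parts and has to be there: with \<open>|z| \<le> 1\<close> the identity then says exactly that
  \<open>- (\<beta> z)\<^sub>x\<close> is a subgradient at \<open>u t\<close> of the energy on the right-hand side, since
  \<open>- \<integral> v (\<beta> z)\<^sub>x + g p1 * q p1 - g p0 * q p0\<close> is a lower bound of the energy at every \<open>v\<close>.
  Without it, no stationary solution could have positive energy.\<close>

definition tv_flow_solution ::
    "real \<Rightarrow> real \<Rightarrow> real \<Rightarrow> (real \<Rightarrow> real \<Rightarrow> real) \<Rightarrow> (real \<Rightarrow> real) \<Rightarrow>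
     (real \<Rightarrow> real \<Rightarrow> real) \<Rightarrow> bool" where
  "tv_flow_solution p0 p1 T \<beta> g u \<longleftrightarrow>
     continuous_L2 {0..<T} {p0<..<p1} u \<and>
     (\<exists>z :: real \<Rightarrow> real \<Rightarrow> real.
        set_borel_measurable lebesgue ({p0<..<p1} \<times> {0<..<T}) (\<lambda>(x, t). z x t) \<and>
        (AE (x, t) in lebesgue. (x, t) \<in> {p0<..<p1} \<times> {0<..<T} \<longrightarrow> \<bar>z x t\<bar> \<le> 1) \<and>
        (\<forall>\<phi> \<phi>x \<phi>t. test_fun2 ({p0<..<p1} \<times> {0<..<T}) \<phi> \<phi>x \<phi>t \<longrightarrow>
           (LINT t:{0<..<T}|lebesgue. LINT x:{p0<..<p1}|lebesgue. u t x * \<phi>t (x, t)) =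
           (LINT t:{0<..<T}|lebesgue. LINT x:{p0<..<p1}|lebesgue. \<beta> x t * z x t * \<phi>x (x, t))) \<and>
        (AE t in lebesgue. t \<in> {0<..<T} \<longrightarrow>
           (\<exists>w \<gamma> q.
              square_integrable_on {p0<..<p1} w \<and>
              has_weak_derivative {p0<..<p1} (\<lambda>x. \<beta> x t * z x t) w \<and>
              (\<forall>p\<in>{p0, p1}. has_trace {p0<..<p1} (u t) p (\<gamma> p)) \<and>
              (\<forall>p\<in>{p0, p1}. has_trace {p0<..<p1} (\<lambda>x. \<beta> x t * z x t) p (q p)) \<and>
              ereal (- (LINT x:{p0<..<p1}|lebesgue. u t x * w x) + (g p1 * q p1 - g p0 * q p0)) =
              tv_energy p0 p1 (\<lambda>x. \<beta> x t) g (u t) \<gamma>)))"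

definition tv_flow_stationary_solution ::
    "real \<Rightarrow> real \<Rightarrow> (real \<Rightarrow> real) \<Rightarrow> (real \<Rightarrow> real) \<Rightarrow> (real \<Rightarrow> real) \<Rightarrow> bool" where
  "tv_flow_stationary_solution p0 p1 \<beta> g v \<longleftrightarrow>
     (\<forall>T>0. tv_flow_solution p0 p1 T (\<lambda>x t. \<beta> x) g (\<lambda>t. v))"

end

theory Submission
  imports Defs
begin

text \<open>The Cahn--Hoffman field is \<open>z x = \<beta> 0 / \<beta> x\<close>: minimality of \<open>\<beta>\<close> at \<open>0\<close> gives
  \<open>\<bar>z\<bar> \<le> 1\<close>, and the flux \<open>\<beta> z\<close> is the constant \<open>\<beta> 0\<close>. The traces of the step function
  match the boundary data, so the energy is its weighted total variation \<open>b * \<beta> 0\<close>, which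
  equals the boundary pairing of the constant flux with the data.\<close>

section \<open>Lebesgue integrals over open intervals and against a step function\<close>

text \<open>The two endpoints form a null set. This is the bridge from the set integrals of the
  definitions to gauge integrals over closed intervals, where the fundamental theorem of calculus
  and the interchange of iterated integrals of continuous functions apply.\<close>

lemma LINT_open_interval_eq_integral:
  fixes h :: "real \<Rightarrow> real"
  assumes "continuous_on {a..b} h"
  shows "(LINT x:{a<..<b}|lebesgue. h x) = integral {a..b} h"
proof -
  have "set_integrable lborel {a..b} h"
    using assms by (rule borel_integrable_atLeastAtMost')
  then have "set_integrable lebesgue {a..b} h"
    unfolding set_integrable_def by (simp add: integrable_completion)
  then have "set_integrable lebesgue {a<..<b} h"
    by (rule set_integrable_subset) auto
  then show ?thesis
    by (simp add: set_lebesgue_integral_eq_integral(2) integral_open_interval_real)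
qed

lemma LINT_step_mult:
  fixes h u :: "real \<Rightarrow> real"
  assumes "L > 0" and h: "continuous_on UNIV h"
    and u: "\<forall>x\<in>{0<..<L}. u x = b" "\<forall>x\<in>{-L<..<0}. u x = 0"
  shows "(LINT x:{-L<..<L}|lebesgue. u x * h x) = b * integral {0..L} h"
proof -
  \<comment> \<open>The value \<open>u 0\<close> is arbitrary, so it is kept as a separate term. The
    identity then holds at every point, and its right-hand side is visibly Borel; this is how
    measurability of the integrand is obtained before the null set \<open>{0}\<close> is
    discarded.\<close>
  have eq: "indicator {-L<..<L} x * u x = b * indicator {0<..<L} x + u 0 * indicator {0} x" for x
    using u \<open>L > 0\<close> by (auto simp: indicator_def)
  have [measurable]: "h \<in> borel_measurable borel"
    using h by (rule borel_measurable_continuous_onI)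
  have "(LINT x:{-L<..<L}|lebesgue. u x * h x)
      = (LINT x|lebesgue. (b * indicator {0<..<L} x + u 0 * indicator {0} x) * h x)"
    unfolding set_lebesgue_integral_def eq[symmetric] by (simp add: mult.assoc)
  also have "\<dots> = (LINT x|lebesgue. indicator {0<..<L} x * (b * h x))"
  proof (rule integral_cong_AE)
    have "AE x in lebesgue. x \<noteq> (0::real)"
      by (rule AE_completion[OF AE_lborel_singleton])
    then show "AE x in lebesgue. (b * indicator {0<..<L} x + u 0 * indicator {0} x) * h x
        = indicator {0<..<L} x * (b * h x)"
      by eventually_elim (auto simp: indicator_def)
  qed (rule measurable_completion, measurable)+
  also have "\<dots> = (LINT x:{0<..<L}|lebesgue. b * h x)"
    by (simp only: set_lebesgue_integral_def real_scaleR_def)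
  also have "\<dots> = integral {0..L} (\<lambda>x. b * h x)"
    by (intro LINT_open_interval_eq_integral continuous_intros continuous_on_subset[OF h]) simp
  finally show ?thesis by simp
qed

lemma set_integrable_const_subset_interval:
  assumes "A \<in> sets lebesgue" "A \<subseteq> {a..b::real}"
  shows "set_integrable lebesgue A (\<lambda>x. c::real)"
proof -
  have "emeasure lebesgue A \<le> emeasure lebesgue {a..b}"
    using assms by (intro emeasure_mono) auto
  also have "\<dots> < \<infinity>"
    by (simp add: emeasure_lborel_Icc_eq)
  finally show ?thesis
    using assms(1) unfolding set_integrable_def by simp
qed

section \<open>Test functions of one variable, weak derivatives and traces\<close>

lemma test_fun_zero_outside: "test_fun I \<phi> \<Longrightarrow> x \<notin> I \<Longrightarrow> \<phi> x = 0"
  by (auto simp: test_fun_def)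

lemma test_fun_deriv:
  assumes "test_fun I \<phi>"
  shows "(\<phi> has_vector_derivative deriv \<phi> x) (at x within S)" "continuous_on S (deriv \<phi>)"
proof -
  obtain D where D: "\<And>x. (\<phi> has_vector_derivative D x) (at x)" "continuous_on UNIV D"
    using assms by (auto simp: test_fun_def C1_differentiable_on_def)
  have "deriv \<phi> = D"
    using D(1) by (auto simp: fun_eq_iff has_real_derivative_iff_has_vector_derivative intro!: DERIV_imp_deriv)
  with D show "(\<phi> has_vector_derivative deriv \<phi> x) (at x within S)" "continuous_on S (deriv \<phi>)"
    by (auto intro: has_vector_derivative_at_within continuous_on_subset)
qed

lemma integral_deriv_test_fun:
  assumes "test_fun I \<phi>" "a \<le> b"
  shows "integral {a..b} (deriv \<phi>) = \<phi> b - \<phi> a"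
  using assms by (intro integral_unique fundamental_theorem_of_calculus test_fun_deriv(1))

text \<open>A test function vanishes at both endpoints, so its derivative has integral zero. The
  value of \<open>f\<close> is prescribed only inside the interval, because the flux is known to be
  constant only there.\<close>

lemma has_weak_derivative_const:
  assumes "a \<le> b" and f: "\<forall>x\<in>{a<..<b}. f x = c"
  shows "has_weak_derivative {a<..<b} f (\<lambda>x. 0)"
  unfolding has_weak_derivative_def
proof (intro conjI allI impI)
  show "locally_integrable {a<..<b} f"
    unfolding locally_integrable_def
  proof (intro allI impI)
    fix K assume K: "compact K \<and> K \<subseteq> {a<..<b}"
    have "set_integrable lebesgue K (\<lambda>x. c)"
      using K by (intro set_integrable_const_subset_interval[of _ a b]) (auto simp: lmeasurable_compact fmeasurableD)
    then show "set_integrable lebesgue K f"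
      by (rule set_integrable_cong[THEN iffD1, rotated -1]) (use K f in auto)
  qed
  show "locally_integrable {a<..<b} (\<lambda>x. 0)"
    by (simp add: locally_integrable_def set_integrable_def)
  fix \<phi> assume \<phi>: "test_fun {a<..<b} \<phi>"
  have "(LINT x:{a<..<b}|lebesgue. f x * deriv \<phi> x) = (LINT x:{a<..<b}|lebesgue. c * deriv \<phi> x)"
    using f by (intro set_lebesgue_integral_cong) auto
  also have "\<dots> = c * integral {a..b} (deriv \<phi>)"
    using LINT_open_interval_eq_integral[of a b "\<lambda>x. c * deriv \<phi> x"] test_fun_deriv(2)[OF \<phi>]
    by (simp add: continuous_intros)
  also have "\<dots> = 0"
    using integral_deriv_test_fun[OF \<phi> \<open>a \<le> b\<close>] test_fun_zero_outside[OF \<phi>] by simp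
  finally show "(LINT x:{a<..<b}|lebesgue. f x * deriv \<phi> x) = - (LINT x:{a<..<b}|lebesgue. 0 * \<phi> x)"
    by simp
qed

text \<open>For radii below \<open>\<epsilon>\<close> the mean deviation from \<open>c\<close> is
  exactly zero, so the limit is that of an eventually vanishing function.\<close>

lemma has_trace_eventually_const:
  assumes "\<epsilon> > 0" and f: "\<forall>x\<in>{a<..<b}. dist p x < \<epsilon> \<longrightarrow> f x = c"
  shows "has_trace {a<..<b} f p c"
proof -
  have ev: "\<forall>\<^sub>F r in at_right 0. 0 < r \<and> r < \<epsilon>"
    using \<open>\<epsilon> > 0\<close> by (auto simp: eventually_at_right_field)
  have "set_integrable lebesgue ({a<..<b} \<inter> ball p r) f" if "r < \<epsilon>" for r
  proof -
    have "set_integrable lebesgue ({a<..<b} \<inter> ball p r) (\<lambda>x. c)"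
      by (intro set_integrable_const_subset_interval[of _ a b]) auto
    then show ?thesis
      by (rule set_integrable_cong[THEN iffD1, rotated -1]) (use that f in auto)
  qed
  moreover have "(LINT x:({a<..<b} \<inter> ball p r)|lebesgue. \<bar>f x - c\<bar>) = 0" if "r < \<epsilon>" for r
  proof -
    have "(LINT x:({a<..<b} \<inter> ball p r)|lebesgue. \<bar>f x - c\<bar>)
        = (LINT x:({a<..<b} \<inter> ball p r)|lebesgue. 0)"
      using that f by (intro set_lebesgue_integral_cong) auto
    then show ?thesis by simp
  qed
  ultimately show ?thesis
    unfolding has_trace_def
    by (intro conjI tendsto_eventually; intro eventually_mono[OF ev]) simp_all
qed

section \<open>The weighted total variation of a step\<close>

text \<open>Supplies the profile of the maximizer in the duality formula for the total variation: it
  peaks at the jump point and stays between 0 and 1.\<close>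

lemma test_fun_bump:
  assumes "L > 0"
  obtains \<phi> where "test_fun {-L<..<L} \<phi>" "\<phi> 0 = 1" "\<And>x. 0 \<le> \<phi> x" "\<And>x. \<phi> x \<le> 1"
proof
  define s :: "real \<Rightarrow> real" where "s x = 1 - (2 * x / L)\<^sup>2" for x
  \<comment> \<open>Squaring the positive part removes its corner and makes the truncation C1. The
    factor 2 inside \<open>s\<close> confines the support to \<open>{-L/2..L/2}\<close>, a compact
    subset of the open interval.\<close>
  define \<phi> where "\<phi> x = (max 0 (s x))\<^sup>2" for x
  have pos: "((\<lambda>y. (max 0 y)\<^sup>2) has_real_derivative 2 * max 0 y) (at y)" for y :: real
  proof -
    consider "y < 0" | "y = 0" | "y > 0" by linarith
    then show ?thesis
    proof cases
      case 1
      have "((\<lambda>y. 0) has_real_derivative 2 * max 0 y) (at y)" using 1 by simp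
      then show ?thesis
        by (rule has_field_derivative_transform_within_open[where S = "{..<0}"]) (use 1 in auto)
    next
      case 2
      \<comment> \<open>For \<open>h\<close> different from 0 the difference quotient of the squared
        positive part at 0 is \<open>max 0 h\<close> itself, which tends to 0.\<close>
      have "((\<lambda>h. max 0 h) \<longlongrightarrow> max 0 0) (at (0::real))"
        by (intro tendsto_intros)
      then have "((\<lambda>h. (max 0 h)\<^sup>2 / h) \<longlongrightarrow> max 0 0) (at (0::real))"
        by (rule Lim_transform_eventually)
          (auto simp: eventually_at_filter power2_eq_square max_def)
      then show ?thesis using 2 by (simp add: DERIV_def)
    next
      case 3
      have "((\<lambda>y. y\<^sup>2) has_real_derivative 2 * max 0 y) (at y)"
        using 3 by (auto intro!: derivative_eq_intros)
      then show ?thesis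
        by (rule has_field_derivative_transform_within_open[where S = "{0<..}"]) (use 3 in auto)
    qed
  qed
  have s: "(s has_real_derivative - (8 * x / L\<^sup>2)) (at x)" for x
    unfolding s_def using assms
    by (auto intro!: derivative_eq_intros simp: power2_eq_square field_simps)
  have "(\<phi> has_real_derivative 2 * max 0 (s x) * (- (8 * x / L\<^sup>2))) (at x)" for x
    using DERIV_chain2[OF pos s] by (simp add: \<phi>_def[abs_def])
  moreover have "continuous_on UNIV (\<lambda>x. 2 * max 0 (s x) * (- (8 * x / L\<^sup>2)))"
    unfolding s_def using assms by (intro continuous_intros) auto
  ultimately have "\<phi> C1_differentiable_on UNIV"
    unfolding C1_differentiable_on_def has_real_derivative_iff_has_vector_derivative
    by (intro exI[of _ "\<lambda>x. 2 * max 0 (s x) * (- (8 * x / L\<^sup>2))"]) auto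
  moreover have "\<phi> x = 0" if "x \<notin> {-L/2..L/2}" for x
  proof -
    have "1 \<le> \<bar>2 * x / L\<bar>" using that assms by (auto simp: field_simps abs_if)
    then have "1 \<le> (2 * x / L)\<^sup>2"
      using abs_le_square_iff[of 1 "2 * x / L"] by simp
    then show ?thesis by (simp add: \<phi>_def s_def)
  qed
  ultimately show "test_fun {-L<..<L} \<phi>"
    unfolding test_fun_def using assms by (intro conjI exI[of _ "{-L/2..L/2}"]) auto
  show "\<phi> 0 = 1" by (simp add: \<phi>_def s_def)
  show "0 \<le> \<phi> x" for x by (simp add: \<phi>_def)
  show "\<phi> x \<le> 1" for x
    unfolding \<phi>_def by (rule power_le_one) (auto simp: s_def)
qed

text \<open>Against a test function \<open>\<phi>\<close> the step integrates to
  \<open>- b * \<phi> 0\<close>, since the fundamental theorem on \<open>{0..L}\<close> leaves only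
  the value at the jump. The supremum is thus \<open>b\<close> times the largest admissible value of
  \<open>- \<phi> 0\<close>: the constraint at 0 bounds that value by \<open>\<beta> 0\<close>, and
  a scaled bump attains it.\<close>

lemma weighted_tv_step:
  assumes "L > 0" "b \<ge> 0" and "0 \<le> \<beta> 0" and min: "\<forall>x\<in>{-L<..<L}. \<beta> 0 \<le> \<beta> x"
    and u: "\<forall>x\<in>{0<..<L}. u x = b" "\<forall>x\<in>{-L<..<0}. u x = 0"
  shows "weighted_tv {-L<..<L} \<beta> u = ereal (b * \<beta> 0)"
proof -
  have val: "(LINT x:{-L<..<L}|lebesgue. u x * deriv \<phi> x) = - b * \<phi> 0"
    if "test_fun {-L<..<L} \<phi>" for \<phi>
    using LINT_step_mult[OF \<open>L > 0\<close> test_fun_deriv(2)[OF that] u]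
      integral_deriv_test_fun[OF that, of 0 L] test_fun_zero_outside[OF that, of L] \<open>L > 0\<close> by simp
  obtain \<psi> where \<psi>: "test_fun {-L<..<L} \<psi>" "\<psi> 0 = 1" "\<And>x. 0 \<le> \<psi> x" "\<And>x. \<psi> x \<le> 1"
    using test_fun_bump[OF \<open>L > 0\<close>] by metis
  \<comment> \<open>The minus sign cancels the one in \<open>val\<close>. As \<open>\<psi>\<close>
    lies between 0 and 1, the modulus is at most \<open>\<beta> 0\<close>, and minimality of
    \<open>\<beta>\<close> at 0 turns this into admissibility on the whole interval.\<close>
  let ?\<phi> = "\<lambda>x. - \<beta> 0 * \<psi> x"
  have t: "test_fun {-L<..<L} ?\<phi>"
    using \<psi>(1) unfolding test_fun_def by (auto intro: C1_differentiable_on_mult)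
  have "\<bar>?\<phi> x\<bar> \<le> \<beta> x" if "x \<in> {-L<..<L}" for x
  proof -
    have "\<bar>?\<phi> x\<bar> = \<beta> 0 * \<psi> x"
      using \<psi>(3)[of x] \<open>0 \<le> \<beta> 0\<close> by (simp add: abs_mult)
    also have "\<dots> \<le> \<beta> 0"
      using \<psi>(4)[of x] \<open>0 \<le> \<beta> 0\<close> by (simp add: mult_left_le)
    finally show ?thesis using min that by force
  qed
  with t have mem: "?\<phi> \<in> {\<phi>. test_fun {-L<..<L} \<phi> \<and> (\<forall>x\<in>{-L<..<L}. \<bar>\<phi> x\<bar> \<le> \<beta> x)}"
    by blast
  show ?thesis
    unfolding weighted_tv_def
  proof (rule antisym)
    show "(SUP \<phi>\<in>{\<phi>. test_fun {-L<..<L} \<phi> \<and> (\<forall>x\<in>{-L<..<L}. \<bar>\<phi> x\<bar> \<le> \<beta> x)}.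
        ereal (LINT x:{-L<..<L}|lebesgue. u x * deriv \<phi> x)) \<le> ereal (b * \<beta> 0)"
    proof (rule SUP_least)
      fix \<phi> assume "\<phi> \<in> {\<phi>. test_fun {-L<..<L} \<phi> \<and> (\<forall>x\<in>{-L<..<L}. \<bar>\<phi> x\<bar> \<le> \<beta> x)}"
      then have \<phi>: "test_fun {-L<..<L} \<phi>" "- \<phi> 0 \<le> \<beta> 0"
        using \<open>L > 0\<close> by (auto dest!: bspec[of _ _ 0])
      show "ereal (LINT x:{-L<..<L}|lebesgue. u x * deriv \<phi> x) \<le> ereal (b * \<beta> 0)"
        using mult_left_mono[OF \<phi>(2) \<open>b \<ge> 0\<close>] by (simp add: val[OF \<phi>(1)])
    qed
    show "ereal (b * \<beta> 0) \<le> (SUP \<phi>\<in>{\<phi>. test_fun {-L<..<L} \<phi> \<and> (\<forall>x\<in>{-L<..<L}. \<bar>\<phi> x\<bar> \<le> \<beta> x)}.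
        ereal (LINT x:{-L<..<L}|lebesgue. u x * deriv \<phi> x))"
      using mem by (rule SUP_upper2) (simp only: val[OF t] \<psi>(2), simp)
  qed
qed

section \<open>Test functions of space and time\<close>

lemma test_fun2_zero_outside: "test_fun2 \<Omega> \<phi> \<phi>x \<phi>t \<Longrightarrow> p \<notin> \<Omega> \<Longrightarrow> \<phi> p = 0"
  unfolding test_fun2_def by blast

text \<open>The fundamental theorem along the segment at time \<open>t\<close>: both ends of the
  segment lie outside the open rectangle, where \<open>\<phi>\<close> is zero.\<close>

lemma test_fun2_integral_space:
  assumes "test_fun2 ({a<..<b} \<times> J) \<phi> \<phi>x \<phi>t" "a \<le> b"
  shows "integral {a..b} (\<lambda>x. \<phi>x (x, t)) = 0"
proof -
  have "((\<lambda>x. \<phi> (x, t)) has_vector_derivative \<phi>x (x, t)) (at x within {a..b})" for x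
  proof -
    have "((\<lambda>x. (x, t)) has_derivative (\<lambda>h. (h, 0))) (at x within {a..b})"
      by (auto intro!: derivative_eq_intros)
    moreover have "(\<phi> has_derivative (\<lambda>h. \<phi>x (x, t) * fst h + \<phi>t (x, t) * snd h)) (at (x, t))"
      using assms(1) by (simp add: test_fun2_def)
    ultimately have "((\<lambda>x. \<phi> (x, t)) has_derivative
        (\<lambda>h. \<phi>x (x, t) * fst (h, 0::real) + \<phi>t (x, t) * snd (h, 0::real))) (at x within {a..b})"
      by (rule has_derivative_compose)
    then show ?thesis by (simp add: has_vector_derivative_def mult.commute)
  qed
  then have "integral {a..b} (\<lambda>x. \<phi>x (x, t)) = \<phi> (b, t) - \<phi> (a, t)"
    by (intro integral_unique fundamental_theorem_of_calculus \<open>a \<le> b\<close>)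
  also have "\<dots> = 0" using test_fun2_zero_outside[OF assms(1)] by simp
  finally show ?thesis .
qed

text \<open>Exchanging the coordinates exchanges the two partial derivatives, so the vanishing of
  the time integral of \<open>\<phi>t\<close> follows from the statement for space.\<close>

lemma test_fun2_swap:
  assumes "test_fun2 (I \<times> J) \<phi> \<phi>x \<phi>t"
  shows "test_fun2 (J \<times> I) (\<phi> \<circ> prod.swap) (\<phi>t \<circ> prod.swap) (\<phi>x \<circ> prod.swap)"
proof -
  have swap: "(prod.swap has_derivative prod.swap) (at p)" for p :: "real \<times> real"
    unfolding prod.swap_def[abs_def] by (auto intro!: derivative_eq_intros)
  have cont: "continuous_on S prod.swap" for S :: "(real \<times> real) set"
    by (rule continuous_on_swap)
  obtain K where K: "compact K" "K \<subseteq> I \<times> J" "\<And>p. p \<notin> K \<Longrightarrow> \<phi> p = 0"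
    using assms by (auto simp: test_fun2_def)
  show ?thesis
    unfolding test_fun2_def
  proof (intro conjI allI)
    fix p :: "real \<times> real"
    have "(\<phi> has_derivative (\<lambda>h. \<phi>x (prod.swap p) * fst h + \<phi>t (prod.swap p) * snd h)) (at (prod.swap p))"
      using assms unfolding test_fun2_def by blast
    from has_derivative_compose[OF swap this]
    show "(\<phi> \<circ> prod.swap has_derivative
        (\<lambda>h. (\<phi>t \<circ> prod.swap) p * fst h + (\<phi>x \<circ> prod.swap) p * snd h)) (at p)"
      by (simp add: o_def add.commute)
  next
    show "continuous_on UNIV (\<phi>t \<circ> prod.swap)" "continuous_on UNIV (\<phi>x \<circ> prod.swap)"
      using assms by (auto simp only: test_fun2_def intro!: continuous_on_compose cont
          intro: continuous_on_subset)
    show "\<exists>K. compact K \<and> K \<subseteq> J \<times> I \<and> (\<forall>p. p \<notin> K \<longrightarrow> (\<phi> \<circ> prod.swap) p = 0)"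
      using K by (intro exI[of _ "prod.swap ` K"])
        (auto intro!: compact_continuous_image cont simp: image_iff, force+)
  qed
qed

lemma test_fun2_integral_time:
  assumes "test_fun2 (I \<times> {a<..<b}) \<phi> \<phi>x \<phi>t" "a \<le> b"
  shows "integral {a..b} (\<lambda>t. \<phi>t (x, t)) = 0"
  using test_fun2_integral_space[OF test_fun2_swap[OF assms(1)] assms(2)] by simp

section \<open>Verification of each clause of the solution concept\<close>

theorem lemma1p1:
  fixes L b :: real and \<beta> g u :: "real \<Rightarrow> real"
  assumes "L > 0" and "b > 0"
    and "continuous_on {-L..L} \<beta>"
    and "\<forall>x\<in>{-L..L}. 0 \<le> \<beta> x"
    and "\<forall>x\<in>{-L<..<L}. \<beta> 0 \<le> \<beta> x"
    and "g (-L) = 0" and "g L = b"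
    and "\<forall>x\<in>{0<..<L}. u x = b"
    and "\<forall>x\<in>{-L<..<0}. u x = 0"
  shows "tv_flow_stationary_solution (-L) L \<beta> g u"
  unfolding tv_flow_stationary_solution_def tv_flow_solution_def
proof (intro allI impI conjI exI[of _ "\<lambda>x t. \<beta> 0 / \<beta> x"])
  fix T :: real assume "T > 0"
  note u = assms(8,9)
  have \<beta>0: "0 \<le> \<beta> 0" using assms(1,4) by simp
  \<comment> \<open>Where \<open>\<beta> x = 0\<close>, minimality and nonnegativity force
    \<open>\<beta> 0 = 0\<close>, and the convention that division by zero gives 0 keeps the
    identity true.\<close>
  have flux: "\<beta> x * (\<beta> 0 / \<beta> x) = \<beta> 0" if "x \<in> {-L<..<L}" for x
    using assms(5) \<beta>0 that by (cases "\<beta> x = 0") fastforce+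
  have u_eq: "indicator {-L<..<L} x * u x = b * indicator {0<..<L} x + u 0 * indicator {0} x" for x
    using u \<open>L > 0\<close> by (auto simp: indicator_def)
  have "square_integrable_on {-L<..<L} u"
    unfolding square_integrable_on_def
  proof
    show "set_borel_measurable lebesgue {-L<..<L} u"
      unfolding set_borel_measurable_def real_scaleR_def u_eq by (rule measurable_completion) measurable
    have "indicator {-L<..<L} x * (u x)\<^sup>2
        = indicator {0<..<L} x * b\<^sup>2 + indicator {0} x * (u 0)\<^sup>2" for x
      using u \<open>L > 0\<close> by (auto simp: indicator_def)
    moreover have "set_integrable lebesgue {0<..<L} (\<lambda>x. b\<^sup>2)" "set_integrable lebesgue {0::real} (\<lambda>x. (u 0)\<^sup>2)"
      using \<open>L > 0\<close> by (auto intro!: set_integrable_const_subset_interval[of _ 0 L])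
    ultimately show "set_integrable lebesgue {-L<..<L} (\<lambda>x. (u x)\<^sup>2)"
      unfolding set_integrable_def by simp
  qed
  then show "continuous_L2 {0..<T} {-L<..<L} (\<lambda>t. u)"
    by (simp add: continuous_L2_def)
  \<comment> \<open>Continuity of \<open>\<beta>\<close> is known only on the closed interval, so
    measurability is stated for its cutoff.\<close>
  have \<beta>_meas [measurable]: "(\<lambda>x. indicator {-L<..<L} x * \<beta> x) \<in> borel_measurable borel"
    using borel_measurable_continuous_on_indicator[of "{-L<..<L}" \<beta>]
      continuous_on_subset[OF assms(3), of "{-L<..<L}"]
    by (simp add: greaterThanLessThan_subseteq_atLeastAtMost_iff)
  \<comment> \<open>The spatial indicator moves into the denominator: outside the interval the
    quotient becomes a division by zero, hence 0. Now \<open>\<beta>\<close> enters only through its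
    Borel cutoff.\<close>
  have "(\<lambda>p. indicator ({-L<..<L} \<times> {0<..<T}) p * (\<beta> 0 / \<beta> (fst p)))
      = (\<lambda>p. indicator {0<..<T} (snd p) * (\<beta> 0 / (indicator {-L<..<L} (fst p) * \<beta> (fst p))))"
    by (auto simp: fun_eq_iff indicator_def)
  also have "\<dots> \<in> borel_measurable lebesgue"
  proof (rule measurable_completion)
    have [measurable]: "(\<lambda>p::real\<times>real. indicator {-L<..<L} (fst p) * \<beta> (fst p)) \<in> borel_measurable borel"
      by (rule measurable_compose[OF _ \<beta>_meas]) (simp add: borel_measurable_continuous_onI continuous_on_fst)
    have [measurable]: "(snd :: real\<times>real \<Rightarrow> real) \<in> borel_measurable borel"
      by (simp add: borel_measurable_continuous_onI continuous_on_snd)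
    show "(\<lambda>p. indicator {0<..<T} (snd p) * (\<beta> 0 / (indicator {-L<..<L} (fst p) * \<beta> (fst p))))
        \<in> borel_measurable lborel"
      by measurable
  qed
  finally show "set_borel_measurable lebesgue ({-L<..<L} \<times> {0<..<T}) (\<lambda>(x, t). \<beta> 0 / \<beta> x)"
    by (simp add: set_borel_measurable_def case_prod_unfold)
  have "\<bar>\<beta> 0 / \<beta> x\<bar> \<le> 1" if "x \<in> {-L<..<L}" for x
    using assms(5) \<beta>0 that by (cases "\<beta> x = 0") (force simp: divide_le_eq_1)+
  then show "AE (x, t) in lebesgue. (x, t) \<in> {-L<..<L} \<times> {0<..<T} \<longrightarrow> \<bar>\<beta> 0 / \<beta> x\<bar> \<le> 1"
    by (intro AE_I2) auto
  show "AE t in lebesgue. t \<in> {0<..<T} \<longrightarrow>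
      (\<exists>w \<gamma> q. square_integrable_on {-L<..<L} w \<and>
        has_weak_derivative {-L<..<L} (\<lambda>x. \<beta> x * (\<beta> 0 / \<beta> x)) w \<and>
        (\<forall>p\<in>{-L, L}. has_trace {-L<..<L} u p (\<gamma> p)) \<and>
        (\<forall>p\<in>{-L, L}. has_trace {-L<..<L} (\<lambda>x. \<beta> x * (\<beta> 0 / \<beta> x)) p (q p)) \<and>
        ereal (- (LINT x:{-L<..<L}|lebesgue. u x * w x) + (g L * q L - g (-L) * q (-L))) =
        tv_energy (-L) L \<beta> g u \<gamma>)"
  \<comment> \<open>The flux is constant, so its derivative \<open>w\<close> is 0 and its trace
    \<open>q\<close> is \<open>\<beta> 0\<close> at both ends. Taking \<open>g\<close> itself as the
    trace of \<open>u\<close> makes the boundary term of the energy vanish.\<close>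
  proof (intro AE_I2 impI, rule exI[of _ "\<lambda>x. 0"], rule exI[of _ g], rule exI[of _ "\<lambda>p. \<beta> 0"],
      intro conjI ballI)
    show "square_integrable_on {-L<..<L} (\<lambda>x. 0)"
      by (simp add: square_integrable_on_def set_borel_measurable_def set_integrable_def)
    show "has_weak_derivative {-L<..<L} (\<lambda>x. \<beta> x * (\<beta> 0 / \<beta> x)) (\<lambda>x. 0)"
      using \<open>L > 0\<close> flux by (intro has_weak_derivative_const) auto
    \<comment> \<open>Points of the interval at distance less than \<open>L\<close> from an endpoint
      lie on the same side of the jump as that endpoint, hence the radius \<open>L\<close>.\<close>
    show "has_trace {-L<..<L} u p (g p)" if "p \<in> {-L, L}" for p
      using that \<open>L > 0\<close> u assms(6,7)
      by (intro has_trace_eventually_const[of L]) (auto simp: dist_real_def)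
    show "has_trace {-L<..<L} (\<lambda>x. \<beta> x * (\<beta> 0 / \<beta> x)) p (\<beta> 0)" for p
      using flux by (intro has_trace_eventually_const[of 1]) auto
    show "ereal (- (LINT x:{-L<..<L}|lebesgue. u x * 0) + (g L * \<beta> 0 - g (-L) * \<beta> 0)) =
        tv_energy (-L) L \<beta> g u g"
      using weighted_tv_step[of L b \<beta> u] assms \<beta>0 by (simp add: tv_energy_def)
  qed
  \<comment> \<open>Both sides of the distributional equation are shown to be zero
    separately.\<close>
  fix \<phi> \<phi>x \<phi>t assume \<phi>: "test_fun2 ({-L<..<L} \<times> {0<..<T}) \<phi> \<phi>x \<phi>t"
  then have cont: "continuous_on S \<phi>x" "continuous_on S \<phi>t" for S
    by (auto simp: test_fun2_def intro: continuous_on_subset)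
  have "(LINT x:{-L<..<L}|lebesgue. u x * \<phi>t (x, t)) = b * integral {0..L} (\<lambda>x. \<phi>t (x, t))" for t
    by (rule LINT_step_mult[OF \<open>L > 0\<close> _ u])
      (auto intro!: continuous_on_compose2[OF cont(2)[of UNIV]] continuous_intros)
  then have "(LINT t:{0<..<T}|lebesgue. LINT x:{-L<..<L}|lebesgue. u x * \<phi>t (x, t))
      = (LINT t:{0<..<T}|lebesgue. b * integral {0..L} (\<lambda>x. \<phi>t (x, t)))"
    by simp
  also have "\<dots> = integral {0..T} (\<lambda>t. b * integral {0..L} (\<lambda>x. \<phi>t (x, t)))"
  proof (rule LINT_open_interval_eq_integral)
    \<comment> \<open>Joint continuity of \<open>\<phi>t\<close> makes the inner integral continuous
      in \<open>t\<close>, as the passage to a gauge integral over \<open>{0..T}\<close>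
      requires.\<close>
    have "continuous_on ({0..T} \<times> cbox 0 L) (\<lambda>(t, x). \<phi>t (x, t))"
      unfolding case_prod_unfold
      by (auto intro!: continuous_on_compose2[OF cont(2)[of UNIV]] continuous_intros)
    then show "continuous_on {0..T} (\<lambda>t. b * integral {0..L} (\<lambda>x. \<phi>t (x, t)))"
      using integral_continuous_on_param[of "{0..T}" 0 L "\<lambda>t x. \<phi>t (x, t)"]
      by (simp add: continuous_intros)
  qed
  \<comment> \<open>Interchanging the integrals puts time inside, where \<open>\<phi>t\<close>
    integrates to zero for each fixed \<open>x\<close>.\<close>
  also have "\<dots> = b * integral {0..L} (\<lambda>x. integral {0..T} (\<lambda>t. \<phi>t (x, t)))"
    using integral_swap_continuous[of 0 0 T L "\<lambda>t x. \<phi>t (x, t)"]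
    by (simp add: case_prod_unfold continuous_on_compose2[OF cont(2)[of UNIV]] continuous_intros)
  also have "\<dots> = 0"
    using test_fun2_integral_time[OF \<phi>] \<open>T > 0\<close> by simp
  finally have lhs: "(LINT t:{0<..<T}|lebesgue. LINT x:{-L<..<L}|lebesgue. u x * \<phi>t (x, t)) = 0" .
  \<comment> \<open>Here the order of integration is already the right one: with constant flux, the
    inner integral of \<open>\<phi>x\<close> vanishes at every time.\<close>
  have "(LINT x:{-L<..<L}|lebesgue. \<beta> x * (\<beta> 0 / \<beta> x) * \<phi>x (x, t)) = 0" for t
  proof -
    have "(LINT x:{-L<..<L}|lebesgue. \<beta> x * (\<beta> 0 / \<beta> x) * \<phi>x (x, t))
        = (LINT x:{-L<..<L}|lebesgue. \<beta> 0 * \<phi>x (x, t))"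
      using flux by (intro set_lebesgue_integral_cong) auto
    also have "\<dots> = integral {-L..L} (\<lambda>x. \<beta> 0 * \<phi>x (x, t))"
      by (rule LINT_open_interval_eq_integral)
        (auto intro!: continuous_on_compose2[OF cont(1)[of UNIV]] continuous_intros)
    also have "\<dots> = 0"
      using test_fun2_integral_space[OF \<phi>] \<open>L > 0\<close> by simp
    finally show ?thesis .
  qed
  with lhs show "(LINT t:{0<..<T}|lebesgue. LINT x:{-L<..<L}|lebesgue. u x * \<phi>t (x, t)) =
      (LINT t:{0<..<T}|lebesgue. LINT x:{-L<..<L}|lebesgue. \<beta> x * (\<beta> 0 / \<beta> x) * \<phi>x (x, t))"
    by simp
qed

end
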